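(* Let $A\in\mathbb{C}^{N\times N}$, $\mathbf b,\mathbf x_0\in\mathbb{C}^N$, $\mathbf r_0=\mathbf b-A\mathbf x_0$, $m\ge 1$, $\varepsilon\in[0,1)$, and let $S\in\mathbb{C}^{s\times N}$ satisfy $$(1-\varepsilon)\|\mathbf v\|^2\le\|S\mathbf v\|^2\le(1+\varepsilon)\|\mathbf v\|^2\qquad\text{for all }\mathbf v\in\mathcal K_{m+1}(A,\mathbf r_0).$$ Let $\widetilde{\mathbf r}_{m-1}$ and $\widetilde{\mathbf r}_m$ be the residuals of the iterates $m-1$ and $m$ of sketched GMRES implemented via the sketched Arnoldi relation $SAV_m=\widehat W_{m+1}\underline{\widehat H_m}$ ($\widetilde{\mathbf r}_0=\mathbf r_0$), and assume $\widetilde{\mathbf r}_{m-1}\ne\mathbf 0$. Then $$\|\widetilde{\mathbf r}_m\|\le\sqrt{\frac{s_m^2+2\varepsilon(1+c_m)}{1-\varepsilon^2}}\;\|\widetilde{\mathbf r}_{m-1}\|,$$ where $s_m=\sin\theta\left(\widetilde{\mathbf r}_{m-1},\,A\mathcal K_m(A,\mathbf r_0)\right)$ and $c_m=\cos\theta\left(\widetilde{\mathbf r}_{m-1},\,A\mathcal K_m(A,\mathbf r_0)\right)$.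
   Context: $\mathcal{K}_j(A,\mathbf r_0)=\mathrm{span}\{\mathbf r_0,\ldots,A^{j-1}\mathbf r_0\}$. $\|\cdot\|$ is the Euclidean norm. For a nonzero vector $\mathbf v$ and subspace $\mathcal W$ with orthogonal projector $P_{\mathcal W}$, $\theta(\mathbf v,\mathcal W)\in[0,\pi/2]$ is defined by $\cos\theta(\mathbf v,\mathcal W)=\|P_{\mathcal W}\mathbf v\|/\|\mathbf v\|$, equivalently $\sin\theta(\mathbf v,\mathcal W)=\|(I-P_{\mathcal W})\mathbf v\|/\|\mathbf v\|$. Sketched GMRES via the sketched Arnoldi relation: $V_{m+1}\in\mathbb{C}^{N\times(m+1)}$ has linearly independent columns, with first column $\mathbf r_0/\|\mathbf r_0\|$; its first $j$ columns $V_j$ form a basis of $\mathcal K_j(A,\mathbf r_0)$ for $j\le m+1$; and $AV_m=V_{m+1}\underline{H_m}$ with $\underline{H_m}\in\mathbb{C}^{(m+1)\times m}$ upper Hessenberg. With the economy QR decomposition $SV_{m+1}=\widehat W_{m+1}R_{m+1}$ ($R_{m+1}$ upper triangular with positive diagonal) and $\underline{\widehat H_m}=R_{m+1}\underline{H_m}$ one has $SAV_m=\widehat W_{m+1}\underline{\widehat H_m}$. For $1\le j\le m$, let $\underline{\widehat H_j}$ be the leading $(j+1)\times j$ block of $\underline{\widehat H_m}$. The $j$-th iterate is $\widetilde{\mathbf x}_j=\mathbf x_0+V_j\widetilde{\mathbf y}_j$, where $\widetilde{\mathbf y}_j$ minimizes $\big\|\underline{\widehat H_j}\mathbf y-\|S\mathbf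 r_0\|\mathbf e_1\big\|$ over $\mathbf y\in\mathbb{C}^j$ (equivalently, minimizes $\|S(\mathbf r_0-AV_j\mathbf y)\|$), with $\widetilde{\mathbf x}_0=\mathbf x_0$; and $\widetilde{\mathbf r}_j=\mathbf b-A\widetilde{\mathbf x}_j$. *)

theory Defs
  imports "HOL-Analysis.Analysis"
begin

text \<open>Vectors in complex coordinate space carry the library's norm, which is the Euclidean one.
  Spans and independence are taken over the complex scalars (\<open>vec.span\<close>, \<open>vec.independent\<close>);
  the unqualified \<open>span\<close> of the library would be the real one.\<close>

definition hdot :: "complex ^ 'n \<Rightarrow> complex ^ 'n \<Rightarrow> complex"
  where "hdot u v = (\<Sum>i\<in>UNIV. cnj (u $ i) * v $ i)"

definition orth_projector :: "(complex ^ 'n) set \<Rightarrow> complex ^ 'n \<Rightarrow> complex ^ 'n"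
  where "orth_projector W v = (THE w. w \<in> W \<and> (\<forall>u\<in>W. hdot u (v - w) = 0))"

definition subspace_angle :: "complex ^ 'n \<Rightarrow> (complex ^ 'n) set \<Rightarrow> real"
  where "subspace_angle v W = arccos (norm (orth_projector W v) / norm v)"

definition krylov :: "complex ^ 'n ^ 'n \<Rightarrow> complex ^ 'n \<Rightarrow> nat \<Rightarrow> (complex ^ 'n) set"
  where "krylov A r j = vec.span ((\<lambda>i. ((*v) A ^^ i) r) ` {..<j})"

definition residual :: "complex ^ 'n ^ 'n \<Rightarrow> complex ^ 'n \<Rightarrow> complex ^ 'n \<Rightarrow> complex ^ 'n"
  where "residual A b x = b - A *v x"

text \<open>Matrices one of whose dimensions depends on \<open>m\<close> are indexed from 0 by natural numbers, and
  only the entries within their bounds matter: \<open>V\<close> and \<open>W\<close> are given by their columns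
  \<open>0..m\<close>, \<open>H\<close> has rows \<open>0..m\<close> and columns \<open>0..<m\<close>, and \<open>R\<close> has
  rows and columns \<open>0..m\<close>.\<close>

definition arnoldi_relation ::
  "complex ^ 'n ^ 'n \<Rightarrow> complex ^ 'n \<Rightarrow> nat \<Rightarrow> (nat \<Rightarrow> complex ^ 'n)
    \<Rightarrow> (nat \<Rightarrow> nat \<Rightarrow> complex) \<Rightarrow> bool"
  where "arnoldi_relation A r m V H \<longleftrightarrow>
    inj_on V {..m} \<and> vec.independent (V ` {..m}) \<and>
    V 0 = (1 / norm r) *\<^sub>R r \<and>
    (\<forall>j\<le>m + 1. vec.span (V ` {..<j}) = krylov A r j) \<and>
    (\<forall>k<m. A *v V k = (\<Sum>i\<le>m. H i k *s V i)) \<and>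
    (\<forall>i\<le>m. \<forall>k<m. i > k + 1 \<longrightarrow> H i k = 0)"

definition economy_QR ::
  "nat \<Rightarrow> (nat \<Rightarrow> complex ^ 's) \<Rightarrow> (nat \<Rightarrow> complex ^ 's)
    \<Rightarrow> (nat \<Rightarrow> nat \<Rightarrow> complex) \<Rightarrow> bool"
  where "economy_QR m B W R \<longleftrightarrow>
    (\<forall>i\<le>m. \<forall>k\<le>m. hdot (W i) (W k) = (if i = k then 1 else 0)) \<and>
    (\<forall>i\<le>m. \<forall>k\<le>m. i > k \<longrightarrow> R i k = 0) \<and>
    (\<forall>k\<le>m. R k k \<in> \<real> \<and> Re (R k k) > 0) \<and>
    (\<forall>k\<le>m. B k = (\<Sum>i\<le>m. R i k *s W i))"

definition sketched_arnoldi ::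
  "complex ^ 'n ^ 'n \<Rightarrow> complex ^ 'n ^ 's \<Rightarrow> complex ^ 'n \<Rightarrow> nat \<Rightarrow> (nat \<Rightarrow> complex ^ 'n)
    \<Rightarrow> (nat \<Rightarrow> nat \<Rightarrow> complex) \<Rightarrow> (nat \<Rightarrow> complex ^ 's) \<Rightarrow> (nat \<Rightarrow> nat \<Rightarrow> complex) \<Rightarrow> bool"
  where "sketched_arnoldi A S r m V H W R \<longleftrightarrow>
    arnoldi_relation A r m V H \<and> economy_QR m (\<lambda>k. S *v V k) W R"

definition H_hat ::
  "nat \<Rightarrow> (nat \<Rightarrow> nat \<Rightarrow> complex) \<Rightarrow> (nat \<Rightarrow> nat \<Rightarrow> complex) \<Rightarrow> nat \<Rightarrow> nat \<Rightarrow> complex"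
  where "H_hat m R H i k = (\<Sum>l\<le>m. R i l * H l k)"

text \<open>The Euclidean norm, on \<open>j + 1\<close> coordinates, of the least-squares residual
  \<open>M y - \<beta> e\<^sub>1\<close>, where \<open>M\<close> is the leading \<open>(j + 1) \<times> j\<close> block of the given array.\<close>

definition projected_residual_norm ::
  "(nat \<Rightarrow> nat \<Rightarrow> complex) \<Rightarrow> real \<Rightarrow> nat \<Rightarrow> (nat \<Rightarrow> complex) \<Rightarrow> real"
  where "projected_residual_norm M \<beta> j y =
    L2_set (\<lambda>i. cmod ((\<Sum>k<j. M i k * y k) - (if i = 0 then of_real \<beta> else 0))) {..j}"

text \<open>The relation "\<open>x\<close> is the \<open>j\<close>-th iterate"; for \<open>j = 0\<close> the sum is empty and
  \<open>x = x0\<close>. Coordinates of \<open>y\<close> from \<open>j\<close> on are irrelevant, so \<open>y\<close> stands for a vector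
  with \<open>j\<close> entries.\<close>

definition sgmres_iterate ::
  "complex ^ 'n ^ 'n \<Rightarrow> complex ^ 'n ^ 's \<Rightarrow> complex ^ 'n \<Rightarrow> complex ^ 'n \<Rightarrow> nat
    \<Rightarrow> (nat \<Rightarrow> complex ^ 'n) \<Rightarrow> (nat \<Rightarrow> nat \<Rightarrow> complex) \<Rightarrow> (nat \<Rightarrow> nat \<Rightarrow> complex)
    \<Rightarrow> nat \<Rightarrow> complex ^ 'n \<Rightarrow> bool"
  where "sgmres_iterate A S b x0 m V H R j x \<longleftrightarrow>
    (\<exists>y. is_arg_min
           (projected_residual_norm (H_hat m R H) (norm (S *v residual A b x0)) j) (\<lambda>_. True) y \<and>
         x = x0 + (\<Sum>k<j. y k *s V k))"

lemma Re_hdot: "Re (hdot u v) = inner u v"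
  by (simp add: hdot_def inner_vec_def inner_complex_def)

lemma hdot_scale_left: "hdot (c *s u) v = cnj c * hdot u v"
  by (simp add: hdot_def sum_distrib_left algebra_simps)

lemma hdot_eq_0_iff_on_subspace:
  assumes "vec.subspace W"
  shows "(\<forall>u\<in>W. hdot u v = 0) \<longleftrightarrow> (\<forall>u\<in>W. inner u v = 0)"
proof
  assume "\<forall>u\<in>W. hdot u v = 0"
  then show "\<forall>u\<in>W. inner u v = 0" by (metis Re_hdot zero_complex.simps(1))
next
  assume *: "\<forall>u\<in>W. inner u v = 0"
  show "\<forall>u\<in>W. hdot u v = 0"
  proof
    fix u assume u: "u \<in> W"
    have "Re (hdot (\<i> *s u) v) = 0"
      using * vec.subspace_scale[OF assms u] by (simp add: Re_hdot)
    then have "Im (hdot u v) = 0" by (simp add: hdot_scale_left)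
    moreover have "Re (hdot u v) = 0" using * u by (simp add: Re_hdot)
    ultimately show "hdot u v = 0" by (simp add: complex_eq_iff)
  qed
qed

lemma orth_projector_unique:
  assumes W: "vec.subspace W"
  shows "\<exists>!w. w \<in> W \<and> (\<forall>u\<in>W. hdot u (v - w) = 0)"
proof -
  have scaleR: "c *\<^sub>R x = complex_of_real c *s x" for c :: real and x :: "complex ^ 'n"
    by (simp add: vec_eq_iff scaleR_conv_of_real[where 'a = complex])
  have "subspace W"
    using W unfolding subspace_def vec.subspace_def by (simp add: scaleR)
  then have span: "span W = W" by (rule span_eq_iff[THEN iffD2])
  obtain y z where y: "y \<in> W" and z: "\<And>w. w \<in> W \<Longrightarrow> orthogonal z w" and v: "v = y + z"
    using orthogonal_subspace_decomp_exists[of W v] unfolding span by metis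
  show ?thesis unfolding hdot_eq_0_iff_on_subspace[OF W]
  proof (rule ex1I[of _ y])
    show "y \<in> W \<and> (\<forall>u\<in>W. inner u (v - y) = 0)"
      using y z v by (simp add: orthogonal_def inner_commute)
    fix w assume w: "w \<in> W \<and> (\<forall>u\<in>W. inner u (v - w) = 0)"
    have "w - y \<in> W" using w y W vec.subspace_diff by blast
    then have "inner (w - y) (v - w) = 0" "inner (w - y) (v - y) = 0"
      using w z[of "w - y"] v by (simp_all add: orthogonal_def inner_commute)
    then have "inner (w - y) (w - y) = 0"
      by (simp add: inner_diff_right)
    then show "w = y" by simp
  qed
qed

lemma orth_projector:
  assumes "vec.subspace W"
  shows "orth_projector W v \<in> W" and "u \<in> W \<Longrightarrow> hdot u (v - orth_projector W v) = 0"
  using theI'[OF orth_projector_unique[OF assms, of v]] unfolding orth_projector_def by auto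

lemma orth_projector_pythagoras:
  assumes "vec.subspace W"
  shows "(norm v)\<^sup>2 = (norm (orth_projector W v))\<^sup>2 + (norm (v - orth_projector W v))\<^sup>2"
proof -
  have "inner (orth_projector W v) (v - orth_projector W v) = 0"
    using orth_projector[OF assms] by (metis Re_hdot zero_complex.simps(1))
  then show ?thesis
    by (simp add: power2_norm_eq_inner inner_diff_left inner_diff_right inner_commute)
qed

lemma cos_sin_subspace_angle:
  assumes "vec.subspace W" and "v \<noteq> 0"
  shows "cos (subspace_angle v W) = norm (orth_projector W v) / norm v"
    and "sin (subspace_angle v W) = norm (v - orth_projector W v) / norm v"
proof -
  let ?c = "norm (orth_projector W v) / norm v"
  have pyth: "(norm v)\<^sup>2 = (norm (orth_projector W v))\<^sup>2 + (norm (v - orth_projector W v))\<^sup>2"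
    by (rule orth_projector_pythagoras[OF assms(1)])
  have "norm (orth_projector W v) \<le> norm v"
    by (rule power2_le_imp_le) (use pyth in auto)
  then have c: "0 \<le> ?c" "?c \<le> 1" using assms(2) by auto
  then have "-1 \<le> ?c" by linarith
  then show "cos (subspace_angle v W) = ?c"
    unfolding subspace_angle_def using c(2) by (rule cos_arccos)
  have "sin (subspace_angle v W) = sqrt (1 - ?c\<^sup>2)"
    unfolding subspace_angle_def using c by (intro sin_arccos_abs) (simp only: abs_of_nonneg)
  also have "1 - ?c\<^sup>2 = (norm (v - orth_projector W v) / norm v)\<^sup>2"
    using pyth assms(2) by (simp add: power_divide field_simps)
  finally show "sin (subspace_angle v W) = norm (v - orth_projector W v) / norm v"
    by simp
qed

end

theory Submission
  imports Defs
begin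

text \<open>Write \<open>L = A K\<^sub>m\<close>. The residual \<open>r\<^sub>m\<close> differs from
  \<open>q = (I - P\<^sub>L) r\<^sub>m\<^sub>-\<^sub>1\<close> by an element \<open>z\<close> of \<open>L\<close>, and \<open>S r\<^sub>m\<close> is orthogonal to
  \<open>S L\<close> because \<open>r\<^sub>m\<close> minimizes the sketched norm over \<open>r\<^sub>0 + L\<close>. So \<open>q\<close> and \<open>z\<close> are
  orthogonal while \<open>r\<^sub>m\<close> and \<open>z\<close> are orthogonal after sketching. An \<open>\<epsilon>\<close>-embedding maps
  only pairs of vectors with cosine at most \<open>\<epsilon>\<close> to orthogonal pairs, whence \<open>\<parallel>z\<parallel> \<le> \<epsilon> \<parallel>r\<^sub>m\<parallel>\<close>
  and \<open>(1 - \<epsilon>\<^sup>2) \<parallel>r\<^sub>m\<parallel>\<^sup>2 \<le> \<parallel>q\<parallel>\<^sup>2 = s\<^sub>m\<^sup>2 \<parallel>r\<^sub>m\<^sub>-\<^sub>1\<parallel>\<^sup>2\<close>. This is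
  stronger than the stated bound.\<close>

section \<open>Inner product geometry: minimality, embeddings, orthonormal sums\<close>

lemma matrix_vector_mult_scaleR: "A *v (t *\<^sub>R v) = t *\<^sub>R (A *v v)"
  for A :: "complex ^ 'n ^ 'm"
  by (simp add: linear_scale)

lemma scaleR_eq_of_real_smult: "t *\<^sub>R v = of_real t *s v" for v :: "complex ^ 'n"
  by (simp add: vec_eq_iff scaleR_conv_of_real[where 'a = complex])

text \<open>Minimality and angles are handled with the real inner product and real multiples,
  whereas Krylov spaces are complex; this keeps the real multiples inside them.\<close>

lemma vec_subspace_scaleR:
  fixes v :: "complex ^ 'n"
  assumes "vec.subspace U" "v \<in> U"
  shows "t *\<^sub>R v \<in> U"
  unfolding scaleR_eq_of_real_smult using assms by (rule vec.subspace_scale)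

lemma norm_add_scaleR_squared:
  fixes u w :: "'a::real_inner"
  shows "(norm (u + t *\<^sub>R w))\<^sup>2 = (norm u)\<^sup>2 + 2 * t * inner u w + t\<^sup>2 * (norm w)\<^sup>2"
  unfolding power2_norm_eq_inner
  by (simp add: inner_add_left inner_add_right inner_commute power2_eq_square algebra_simps)

text \<open>First-order optimality along a real line: a nonzero inner product would let some step
  shorten \<open>u\<close>.\<close>

lemma inner_eq_0_if_norm_minimal:
  fixes u w :: "'a::real_inner"
  assumes "\<And>t. norm u \<le> norm (u + t *\<^sub>R w)"
  shows "inner u w = 0"
proof (cases "w = 0")
  case False
  \<comment> \<open>The minimizer of the quadratic in \<open>t\<close> given by
    \<open>norm_add_scaleR_squared\<close>.\<close>
  define t where "t = - inner u w / (norm w)\<^sup>2"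
  have "(norm u)\<^sup>2 \<le> (norm (u + t *\<^sub>R w))\<^sup>2"
    using assms by (intro power_mono) auto
  also have "\<dots> = (norm u)\<^sup>2 - (inner u w)\<^sup>2 / (norm w)\<^sup>2"
    unfolding norm_add_scaleR_squared t_def using False
    by (simp add: field_simps power2_eq_square)
  finally have "(inner u w)\<^sup>2 / (norm w)\<^sup>2 \<le> 0" by simp
  then show ?thesis using False by (simp add: divide_le_0_iff)
qed simp

text \<open>The images of \<open>\<parallel>w\<parallel> u + \<parallel>u\<parallel> w\<close> and \<open>\<parallel>w\<parallel> u - \<parallel>u\<parallel> w\<close> have equal norm, so the
  embedding property compares the norms of these two vectors.\<close>

lemma embedding_orthogonal_imp_inner_le:
  fixes f :: "'a::real_inner \<Rightarrow> 'b::real_inner"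
  assumes lin: "linear f"
    and emb: "\<And>a c. (1 - \<epsilon>) * (norm (a *\<^sub>R u + c *\<^sub>R w))\<^sup>2 \<le> (norm (f (a *\<^sub>R u + c *\<^sub>R w)))\<^sup>2 \<and>
           (norm (f (a *\<^sub>R u + c *\<^sub>R w)))\<^sup>2 \<le> (1 + \<epsilon>) * (norm (a *\<^sub>R u + c *\<^sub>R w))\<^sup>2"
    and orth: "inner (f u) (f w) = 0"
  shows "- inner u w \<le> \<epsilon> * norm u * norm w"
proof (cases "u = 0 \<or> w = 0")
  case False
  define n where "n = norm u * norm w"
  have n: "n > 0" using False by (simp add: n_def)
  have eq: "(norm (f (norm w *\<^sub>R u + t *\<^sub>R w)))\<^sup>2 = (norm w * norm (f u))\<^sup>2 + t\<^sup>2 * (norm (f w))\<^sup>2" for t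
    using lin orth by (simp add: norm_add_scaleR_squared linear_add linear_scale power_mult_distrib)
  have "(1 - \<epsilon>) * (norm (norm w *\<^sub>R u + (- norm u) *\<^sub>R w))\<^sup>2
      \<le> (1 + \<epsilon>) * (norm (norm w *\<^sub>R u + norm u *\<^sub>R w))\<^sup>2"
    using emb[of "norm w" "- norm u"] emb[of "norm w" "norm u"] eq[of "- norm u"] eq[of "norm u"]
    by simp
  \<comment> \<open>With the norms swapped as weights, both squared terms equal
    \<open>n\<^sup>2\<close>, so the two sides differ only in the sign of the cross term and in the
    embedding factor.\<close>
  then have "(1 - \<epsilon>) * (2 * n\<^sup>2 - 2 * n * inner u w) \<le> (1 + \<epsilon>) * (2 * n\<^sup>2 + 2 * n * inner u w)"
    unfolding norm_add_scaleR_squared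
    by (simp add: n_def power_mult_distrib algebra_simps)
  then have "n * (- inner u w) \<le> n * (\<epsilon> * n)"
    by (simp add: algebra_simps power2_eq_square)
  then have "- inner u w \<le> \<epsilon> * n" using n by (simp only: mult_le_cancel_left_pos)
  then show ?thesis by (simp add: n_def)
qed auto

text \<open>Parseval: orthonormality kills the mixed terms. It turns the least-squares norm of
  coordinates into the norm of a sketched vector.\<close>

lemma norm_sum_orthonormal:
  fixes W :: "nat \<Rightarrow> complex ^ 's"
  assumes "\<And>i k. i \<le> m \<Longrightarrow> k \<le> m \<Longrightarrow> hdot (W i) (W k) = (if i = k then 1 else 0)"
  shows "norm (\<Sum>i\<le>m. a i *s W i) = L2_set (\<lambda>i. cmod (a i)) {..m}"
proof -
  have left: "hdot (\<Sum>i\<in>I. f i) v = (\<Sum>i\<in>I. hdot (f i) v)"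
    for f :: "nat \<Rightarrow> complex ^ 's" and I v
    unfolding hdot_def by (subst sum.swap) (simp add: sum_distrib_right)
  have right: "hdot v (\<Sum>i\<in>I. f i) = (\<Sum>i\<in>I. hdot v (f i))"
    for f :: "nat \<Rightarrow> complex ^ 's" and I v
    unfolding hdot_def by (subst sum.swap) (simp add: sum_distrib_left)
  have scale: "hdot v (c *s w) = c * hdot v w" for v w :: "complex ^ 's" and c
    by (simp add: hdot_def sum_distrib_left algebra_simps)
  have "hdot (\<Sum>i\<le>m. a i *s W i) (\<Sum>i\<le>m. a i *s W i)
      = (\<Sum>i\<le>m. \<Sum>k\<le>m. a i * (cnj (a k) * hdot (W k) (W i)))"
    by (simp add: left right scale hdot_scale_left sum_distrib_left)
  also have "\<dots> = (\<Sum>i\<le>m. \<Sum>k\<le>m. if k = i then cnj (a i) * a i else 0)"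
    using assms by (intro sum.cong refl) auto
  also have "\<dots> = (\<Sum>i\<le>m. cnj (a i) * a i)" by simp
  also have "\<dots> = of_real (\<Sum>i\<le>m. (cmod (a i))\<^sup>2)"
    by (simp only: of_real_sum complex_norm_square mult.commute)
  finally have "(norm (\<Sum>i\<le>m. a i *s W i))\<^sup>2 = (\<Sum>i\<le>m. (cmod (a i))\<^sup>2)"
    unfolding power2_norm_eq_inner Re_hdot[symmetric] by simp
  then show ?thesis
    unfolding L2_set_def by (simp add: real_sqrt_unique)
qed

section \<open>Krylov spaces and coordinates of sketched residuals\<close>

lemma matrix_vector_mult_sum_smult:
  "A *v (\<Sum>k\<in>I. y k *s V k) = (\<Sum>k\<in>I. y k *s (A *v V k))" for A :: "complex ^ 'n ^ 'm"
  by (induct I rule: infinite_finite_induct)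
    (simp_all add: matrix_vector_right_distrib vector_scalar_commute)

text \<open>A span over the set of columns attaches coefficients to vectors; injectivity of
  \<open>V\<close> moves them to column indices, the form in which the iterates are given.\<close>

lemma krylov_span_sum:
  assumes "arnoldi_relation A r m V H" and "j \<le> m + 1"
  shows "krylov A r j = range (\<lambda>y. \<Sum>k<j. y k *s V k)" (is "_ = ?R")
proof -
  have inj: "inj_on V {..<j}" and eq: "krylov A r j = vec.span (V ` {..<j})"
    using assms unfolding arnoldi_relation_def by (auto intro: inj_on_subset)
  show ?thesis
  proof
    show "krylov A r j \<subseteq> ?R"
    proof
      fix v assume "v \<in> krylov A r j"
      then obtain u where "v = (\<Sum>w\<in>V ` {..<j}. u w *s w)"
        unfolding eq vec.span_finite[OF finite_imageI[OF finite_lessThan]] by blast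
      then have "v = (\<Sum>k<j. (u \<circ> V) k *s V k)"
        using inj by (simp add: sum.reindex)
      then show "v \<in> ?R" by blast
    qed
    show "?R \<subseteq> krylov A r j"
      unfolding eq by (intro image_subsetI vec.span_sum vec.span_scale) (simp add: vec.span_base)
  qed
qed

lemma subspace_krylov: "vec.subspace (krylov A r j)"
  by (simp add: krylov_def vec.subspace_span)

lemma krylov_mono: "i \<le> j \<Longrightarrow> krylov A r i \<subseteq> krylov A r j"
  unfolding krylov_def by (intro vec.span_mono image_mono) auto

lemma start_mem_krylov: "j > 0 \<Longrightarrow> r \<in> krylov A r j"
  unfolding krylov_def by (rule vec.span_base, rule image_eqI[of _ _ 0]) auto

lemma subspace_image_krylov: "vec.subspace ((*v) A ` krylov A r j)"
  by (rule vec.linear_subspace_image[OF matrix_vector_mul_linear_gen subspace_krylov])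

text \<open>Multiplication by \<open>A\<close> shifts the Krylov generators by one. For
  \<open>j = m\<close> this places A K_m inside the space on which \<open>S\<close> is an
  embedding.\<close>

lemma image_krylov_subset: "(*v) A ` krylov A r j \<subseteq> krylov A r (Suc j)"
proof -
  have "A *v v \<in> krylov A r (Suc j)" if "v \<in> krylov A r j" for v
    using that unfolding krylov_def
  proof (induct rule: vec.span_induct_alt)
    case base
    show ?case by (simp add: vec.span_zero)
  next
    case (step c x y)
    then obtain i where "i < j" "x = ((*v) A ^^ i) r" by auto
    then have "A *v x \<in> (\<lambda>i. ((*v) A ^^ i) r) ` {..<Suc j}"
      by (intro image_eqI[of _ _ "Suc i"]) auto
    then show ?case
      using step by (simp add: matrix_vector_right_distrib vector_scalar_commute
          vec.span_add vec.span_scale vec.span_base)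
  qed
  then show ?thesis by blast
qed

text \<open>Positivity of the diagonal entry \<open>R 0 0\<close> is what makes \<open>\<parallel>S r\<parallel> e\<^sub>1\<close> the coordinate
  vector of \<open>S r\<close>.\<close>

lemma projected_residual_norm_eq:
  fixes A :: "complex ^ 'n ^ 'n" and S :: "complex ^ 'n ^ 's"
  assumes "sketched_arnoldi A S r m V H W R"
  shows "projected_residual_norm (H_hat m R H) (norm (S *v r)) m y
    = norm (S *v (r - A *v (\<Sum>k<m. y k *s V k)))"
proof -
  have V0: "V 0 = (1 / norm r) *\<^sub>R r"
    and AV: "\<And>k. k < m \<Longrightarrow> A *v V k = (\<Sum>i\<le>m. H i k *s V i)"
    and orthonormal: "\<And>i k. i \<le> m \<Longrightarrow> k \<le> m \<Longrightarrow> hdot (W i) (W k) = (if i = k then 1 else 0)"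
    and upper: "\<And>i k. i \<le> m \<Longrightarrow> k \<le> m \<Longrightarrow> i > k \<Longrightarrow> R i k = 0"
    and R00: "R 0 0 \<in> \<real>" "Re (R 0 0) > 0"
    and SV: "\<And>k. k \<le> m \<Longrightarrow> S *v V k = (\<Sum>i\<le>m. R i k *s W i)"
    using assms unfolding sketched_arnoldi_def arnoldi_relation_def economy_QR_def by auto
  have SV0: "S *v V 0 = R 0 0 *s W 0"
    using SV[of 0] upper by (simp add: sum.atMost_shift)
  have "norm (W 0) = 1"
    using orthonormal[of 0 0] by (simp add: norm_eq_1 Re_hdot[symmetric])
  moreover have R00': "R 0 0 = of_real (Re (R 0 0))"
    using R00 by simp
  ultimately have "norm (S *v V 0) = Re (R 0 0)"
    using R00(2) unfolding SV0 by (metis abs_of_pos mult.right_neutral norm_scaleR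
        scaleR_eq_of_real_smult)
  moreover have r: "r = norm r *\<^sub>R V 0" by (simp add: V0)
  ultimately have \<beta>: "norm (S *v r) = norm r * Re (R 0 0)"
    by (metis abs_norm_cancel matrix_vector_mult_scaleR norm_scaleR)
  have "S *v r = norm r *\<^sub>R (S *v V 0)"
    using r by (metis matrix_vector_mult_scaleR)
  also have "\<dots> = of_real (norm (S *v r)) *s W 0"
    unfolding SV0 \<beta> scaleR_eq_of_real_smult using R00'
    by (metis of_real_mult vector_smult_assoc)
  also have "\<dots> = (\<Sum>i\<le>m. (if i = 0 then of_real (norm (S *v r)) else 0) *s W i)"
    by (simp add: sum.atMost_shift)
  finally have Sr: "S *v r = \<dots>" .
  have SAV: "S *v (A *v V k) = (\<Sum>i\<le>m. H_hat m R H i k *s W i)" if "k < m" for k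
  proof -
    have "S *v (A *v V k) = (\<Sum>l\<le>m. H l k *s (\<Sum>i\<le>m. R i l *s W i))"
      using that by (simp add: AV matrix_vector_mult_sum_smult SV)
    also have "\<dots> = (\<Sum>l\<le>m. \<Sum>i\<le>m. (R i l * H l k) *s W i)"
      by (simp add: vec.scale_sum_right mult.commute)
    also have "\<dots> = (\<Sum>i\<le>m. \<Sum>l\<le>m. (R i l * H l k) *s W i)"
      by (rule sum.swap)
    finally show ?thesis by (simp add: H_hat_def vec.scale_sum_left)
  qed
  have "S *v (A *v (\<Sum>k<m. y k *s V k)) = (\<Sum>k<m. y k *s (\<Sum>i\<le>m. H_hat m R H i k *s W i))"
    by (simp add: matrix_vector_mult_sum_smult SAV)
  also have "\<dots> = (\<Sum>k<m. \<Sum>i\<le>m. (H_hat m R H i k * y k) *s W i)"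
    by (simp add: vec.scale_sum_right mult.commute)
  also have "\<dots> = (\<Sum>i\<le>m. (\<Sum>k<m. H_hat m R H i k * y k) *s W i)"
    by (subst sum.swap) (simp add: vec.scale_sum_left)
  \<comment> \<open>The sign follows the convention \<open>M y - \<beta> e\<^sub>1\<close> of
    \<open>projected_residual_norm\<close>; the norm removes it below.\<close>
  finally have "S *v (A *v (\<Sum>k<m. y k *s V k)) - S *v r
      = (\<Sum>i\<le>m. ((\<Sum>k<m. H_hat m R H i k * y k)
          - (if i = 0 then of_real (norm (S *v r)) else 0)) *s W i)"
    by (subst Sr) (simp only: sum_subtractf[symmetric] vec.scale_left_diff_distrib)
  then have "norm (S *v (r - A *v (\<Sum>k<m. y k *s V k)))
      = norm (\<Sum>i\<le>m. ((\<Sum>k<m. H_hat m R H i k * y k)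
          - (if i = 0 then of_real (norm (S *v r)) else 0)) *s W i)"
    unfolding matrix_vector_mult_diff_distrib by (subst norm_minus_commute) (rule arg_cong)
  also have "\<dots> = L2_set (\<lambda>i. cmod ((\<Sum>k<m. H_hat m R H i k * y k)
          - (if i = 0 then of_real (norm (S *v r)) else 0))) {..m}"
    using orthonormal by (rule norm_sum_orthonormal)
  finally show ?thesis
    unfolding projected_residual_norm_def by (rule sym)
qed

section \<open>Iterates and minimality of their residuals\<close>

lemma residual_add: "residual A b (x0 + v) = residual A b x0 - A *v v"
  by (simp add: residual_def matrix_vector_right_distrib algebra_simps)

lemma sgmres_iterate_mem_krylov:
  assumes "arnoldi_relation A r m V H" and "j \<le> m"
    and "sgmres_iterate A S b x0 m V H R j x"
  obtains v where "v \<in> krylov A r j" and "x = x0 + v"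
  using assms krylov_span_sum[OF assms(1), of j] unfolding sgmres_iterate_def by auto

text \<open>Each \<open>v\<close> in K_m has coordinates in the columns of \<open>V\<close>, and for
  these the projected norm is the sketched residual norm. Minimality in coordinates thus becomes
  minimality over x0 + K_m.\<close>

lemma sgmres_residual_minimal:
  assumes "sketched_arnoldi A S (residual A b x0) m V H W R"
    and "sgmres_iterate A S b x0 m V H R m x"
    and "v \<in> krylov A (residual A b x0) m"
  shows "norm (S *v residual A b x) \<le> norm (S *v residual A b (x0 + v))"
proof -
  obtain y where y: "x = x0 + (\<Sum>k<m. y k *s V k)"
    and min: "\<And>y'. projected_residual_norm (H_hat m R H) (norm (S *v residual A b x0)) m y
      \<le> projected_residual_norm (H_hat m R H) (norm (S *v residual A b x0)) m y'"
    using assms(2) unfolding sgmres_iterate_def is_arg_min_linorder by blast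
  have "arnoldi_relation A (residual A b x0) m V H"
    using assms(1) by (simp add: sketched_arnoldi_def)
  with assms(3) obtain y' where "v = (\<Sum>k<m. y' k *s V k)"
    using krylov_span_sum[of A "residual A b x0" m V H m] by auto
  then show ?thesis
    using min[of y'] unfolding projected_residual_norm_eq[OF assms(1)] y residual_add by simp
qed

section \<open>Comparison of consecutive residuals\<close>

theorem corollary4p7:
  fixes A :: "complex ^ 'n ^ 'n" and S :: "complex ^ 'n ^ 's"
    and b x0 :: "complex ^ 'n" and m :: nat and \<epsilon> :: real
    and V :: "nat \<Rightarrow> complex ^ 'n" and H :: "nat \<Rightarrow> nat \<Rightarrow> complex"
    and W :: "nat \<Rightarrow> complex ^ 's" and R :: "nat \<Rightarrow> nat \<Rightarrow> complex"
    and x :: "nat \<Rightarrow> complex ^ 'n"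
  assumes "m \<ge> 1" and "0 \<le> \<epsilon>" and "\<epsilon> < 1"
    and "\<And>v. v \<in> krylov A (residual A b x0) (m + 1) \<Longrightarrow>
           (1 - \<epsilon>) * (norm v)\<^sup>2 \<le> (norm (S *v v))\<^sup>2 \<and>
           (norm (S *v v))\<^sup>2 \<le> (1 + \<epsilon>) * (norm v)\<^sup>2"
    and "sketched_arnoldi A S (residual A b x0) m V H W R"
    and "\<And>j. j \<le> m \<Longrightarrow> sgmres_iterate A S b x0 m V H R j (x j)"
    and "residual A b (x (m - 1)) \<noteq> 0"
  shows "norm (residual A b (x m))
    \<le> sqrt (((sin (subspace_angle (residual A b (x (m - 1)))
                     ((*v) A ` krylov A (residual A b x0) m)))\<^sup>2
              + 2 * \<epsilon> * (1 + cos (subspace_angle (residual A b (x (m - 1)))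
                     ((*v) A ` krylov A (residual A b x0) m))))
             / (1 - \<epsilon>\<^sup>2))
       * norm (residual A b (x (m - 1)))"
proof -
  let ?r = "residual A b x0" and ?r' = "residual A b (x (m - 1))" and ?rm = "residual A b (x m)"
  let ?K = "krylov A ?r m" and ?K' = "krylov A ?r (m + 1)"
  let ?L = "(*v) A ` ?K"
  define q where "q = ?r' - orth_projector ?L ?r'"
  define z where "z = q - ?rm"
  let ?c = "cos (subspace_angle ?r' ?L)" and ?s = "sin (subspace_angle ?r' ?L)"
  have arnoldi: "arnoldi_relation A ?r m V H"
    using assms(5) by (simp add: sketched_arnoldi_def)
  have L: "vec.subspace ?L" by (rule subspace_image_krylov)
  \<comment> \<open>For \<open>m = 1\<close> this is iterate 0, where the Krylov space is trivial
    and \<open>v' = 0\<close>.\<close>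
  obtain v' where v': "v' \<in> krylov A ?r (m - 1)" "x (m - 1) = x0 + v'"
    using sgmres_iterate_mem_krylov[OF arnoldi _ assms(6)[of "m - 1"]] by auto
  obtain vm where vm: "vm \<in> ?K" "x m = x0 + vm"
    using sgmres_iterate_mem_krylov[OF arnoldi _ assms(6)[of m]] by auto
  have "v' \<in> ?K" using v'(1) krylov_mono[of "m - 1" m] by auto
  then have "vm - v' \<in> ?K"
    using vm(1) by (intro vec.subspace_diff subspace_krylov)
  moreover have "?r' - ?rm = A *v (vm - v')"
    unfolding v'(2) vm(2) residual_add by (simp add: matrix_vector_mult_diff_distrib)
  ultimately have "?r' - ?rm \<in> ?L" by blast
  then have "?r' - ?rm - orth_projector ?L ?r' \<in> ?L"
    by (rule vec.subspace_diff[OF L _ orth_projector(1)[OF L]])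
  then have zL: "z \<in> ?L" by (simp add: z_def q_def algebra_simps)
  have qz: "inner q z = 0"
    using orth_projector(2)[OF L zL, of ?r'] unfolding q_def
    by (metis Re_hdot inner_commute zero_complex.simps(1))
  have LK': "?L \<subseteq> ?K'" using image_krylov_subset[of A ?r m] by simp
  have "?rm \<in> ?K'"
    unfolding vm(2) residual_add using vm(1) LK'
    by (intro vec.subspace_diff subspace_krylov start_mem_krylov) auto
  \<comment> \<open>The angle estimate compares norms on the real plane through \<open>?rm\<close>
    and \<open>z\<close>, so that plane must lie in the embedded space.\<close>
  then have emb: "a *\<^sub>R ?rm + c *\<^sub>R z \<in> ?K'" for a c
    using zL LK' by (intro vec.subspace_add vec_subspace_scaleR subspace_krylov) auto
  obtain w where w: "w \<in> ?K" "z = A *v w" using zL by blast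
  have "norm (S *v ?rm) \<le> norm (S *v ?rm + t *\<^sub>R (S *v z))" for t
  proof -
    \<comment> \<open>Moving the correction by \<open>- t *\<^sub>R w\<close> moves the residual by
      \<open>+ t *\<^sub>R z\<close>, since \<open>z = A *v w\<close>.\<close>
    have "vm - t *\<^sub>R w \<in> ?K"
      using vm(1) w(1) by (intro vec.subspace_diff vec_subspace_scaleR subspace_krylov)
    from sgmres_residual_minimal[OF assms(5) assms(6)[of m] this]
    have "norm (S *v ?rm) \<le> norm (S *v residual A b (x0 + (vm - t *\<^sub>R w)))" by simp
    also have "residual A b (x0 + (vm - t *\<^sub>R w)) = ?rm + t *\<^sub>R z"
      unfolding vm(2) residual_add w(2)
      by (simp add: matrix_vector_mult_diff_distrib matrix_vector_mult_scaleR)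
    finally show ?thesis
      by (simp add: matrix_vector_right_distrib matrix_vector_mult_scaleR)
  qed
  then have "inner (S *v ?rm) (S *v z) = 0" by (rule inner_eq_0_if_norm_minimal)
  then have "- inner ?rm z \<le> \<epsilon> * norm ?rm * norm z"
    using assms(4)[OF emb]
    by (intro embedding_orthogonal_imp_inner_le[of "(*v) S"]) auto
  moreover have rm: "?rm = q - z" by (simp add: z_def)
  \<comment> \<open>As \<open>q\<close> and \<open>z\<close> are orthogonal,
    \<open>inner ?rm z = - (norm z)\<^sup>2\<close>; the angle estimate becomes a bound on
    \<open>z\<close> itself.\<close>
  ultimately have "norm z * norm z \<le> (\<epsilon> * norm ?rm) * norm z"
    using qz by (simp add: inner_diff_left dot_square_norm power2_eq_square)
  then have "norm z \<le> \<epsilon> * norm ?rm"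
    using assms(2) by (cases "z = 0") (auto simp: mult_le_cancel_right)
  then have "(norm z)\<^sup>2 \<le> \<epsilon>\<^sup>2 * (norm ?rm)\<^sup>2"
    by (metis norm_ge_zero power_mono power_mult_distrib)
  \<comment> \<open>Pythagoras for \<open>?rm = q - z\<close>; the bound on \<open>z\<close> is then
    absorbed into the left-hand side, which produces the factor
    \<open>1 - \<epsilon>\<^sup>2\<close>.\<close>
  moreover have "(norm ?rm)\<^sup>2 = (norm q)\<^sup>2 + (norm z)\<^sup>2"
    using norm_add_scaleR_squared[of q "-1" z] qz rm by simp
  ultimately have bound: "(1 - \<epsilon>\<^sup>2) * (norm ?rm)\<^sup>2 \<le> (norm q)\<^sup>2"
    by (simp add: algebra_simps)
  have "(norm q)\<^sup>2 = ?s\<^sup>2 * (norm ?r')\<^sup>2"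
    unfolding cos_sin_subspace_angle(2)[OF L assms(7)] q_def using assms(7)
    by (simp add: power_divide)
  \<comment> \<open>Here the sharper bound is relaxed by a nonnegative term to reach the claimed
    form.\<close>
  also have "\<dots> \<le> (?s\<^sup>2 + 2 * \<epsilon> * (1 + ?c)) * (norm ?r')\<^sup>2"
  proof -
    have "1 + ?c \<ge> 0" using cos_ge_minus_one[of "subspace_angle ?r' ?L"] by linarith
    then have "2 * \<epsilon> * (1 + ?c) \<ge> 0" using assms(2) by (intro mult_nonneg_nonneg) simp_all
    then show ?thesis by (intro mult_right_mono) simp_all
  qed
  finally have "(1 - \<epsilon>\<^sup>2) * (norm ?rm)\<^sup>2 \<le> (?s\<^sup>2 + 2 * \<epsilon> * (1 + ?c)) * (norm ?r')\<^sup>2"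
    using bound by simp
  moreover have "1 - \<epsilon>\<^sup>2 > 0"
    using assms(2,3) by (simp add: abs_square_less_1)
  ultimately have "(norm ?rm)\<^sup>2 \<le> (?s\<^sup>2 + 2 * \<epsilon> * (1 + ?c)) / (1 - \<epsilon>\<^sup>2) * (norm ?r')\<^sup>2"
    by (simp add: field_simps)
  then have "norm ?rm \<le> sqrt ((?s\<^sup>2 + 2 * \<epsilon> * (1 + ?c)) / (1 - \<epsilon>\<^sup>2) * (norm ?r')\<^sup>2)"
    by (rule real_le_rsqrt)
  then show ?thesis unfolding real_sqrt_mult by simp
qed

end
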